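(* Let $G\subset\mathbb{R}^n$ be a geometric graph and let $x\in G$. Then \[ \dim_{\mathrm{Pvec}}\{x\}_G=\dim_{\times}\{x\}_G=\dim_{\mathrm{Ptan}}\{x\}_G=\dim\mathrm{span}\,\mathcal U_G(x), \] the linear rank of the incident edge directions at $x$. Consequently, if $G\neq\varnothing$, \[ \dim_{\mathrm{Pvec}}(G)=\dim_{\times}(G)=\dim_{\mathrm{Ptan}}(G)=\max_{v\in V(G)}\dim\mathrm{span}\,\mathcal U_G(v). \] If $G=\varnothing$, all three global invariants are $0$ by convention.
   Context: Geometric graph: a locally finite union $G=\bigcup_{i\in I}[a_i,b_i]$, $a_i\ne b_i$, of closed straight segments (edges) such that any two distinct edges meet, if at all, in a common endpoint of both segments. The endpoints of edges are the nodes; $V(G)$ is the set of nodes. For $x\in G$, $\mathcal U_G(x)$ is the (finite) set of unit vectors $u\in\mathbb{R}^n$ such that some edge emanates from $x$ along $u$, i.e. $\{x+tu:0<t<\delta\}\subset G$ for some $\delta>0$. Point-vector dimension: $\dim_{\mathrm{Pvec}}\{x\}_A$ is the maximal $k\in\{1,\dots,n\}$ such that there exist linearly independent $v_1,\dots,v_k\in\mathbb{R}^n$ and $\delta>0$ with $\{x+tv_i:0<t<\delta\}\subset A$ for every $i$; it is $0$ if no such $k$ exists. Tangent cone: $\mathrm{Tan}_x(A)$ is the set of $v\in\mathbb{R}^n$ for which there exist $x_k\in A$, $x_k\to x$, and positive reals $\lambda_k\downarrow0$ with $(x_k-x)/\lambda_k\to v$. Point-tangential dimension: $\dim_{\mathrm{Ptan}}\{x\}_A:=\dim\mathrm{span}(\mathrm{Tan}_x(A))$,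 with $\mathrm{span}(\varnothing)=\{0\}$. Effective directions: $\mathrm{Eff}_x(A):=\mathrm{Tan}_x(A)\cap S^{n-1}$ if $x\in\overline A$ (and $\varnothing$ otherwise). For $v\ne0$ let $[v]=\mathbb{R}v\in\mathbb{P}^{n-1}$; $\mathrm{Eff}_x^{\mathbb P}(A):=\{[v]:v\in\mathrm{Eff}_x(A)\}$. Admissible probes: for $x\in\overline A$, $v\in S^{n-1}$, $\mathcal G_x^A(v)$ is the family of all injective Lipschitz maps $\gamma:[0,\delta]\to\mathbb{R}^n$ (some $\delta>0$) with $\gamma(0)=x$, $\lim_{t\to0^+}\frac{\gamma(t)-x}{\|\gamma(t)-x\|}=v$, and $A\cap\gamma((0,\eta])\ne\varnothing$ for every $\eta\in(0,\delta]$; $\Gamma_\gamma:=\gamma([0,\delta])$. Point-extended box dimension: for bounded $E$, $N_\varepsilon(E)$ is the minimal number of sets of diameter at most $\varepsilon$ covering $E$ and $\overline{\dim}_B(E):=\limsup_{\varepsilon\to0}\frac{\ln N_\varepsilon(E)}{\ln(1/\varepsilon)}$. For $x\in\overline E$, $\dim_{\mathrm{Pbox}}\{x\}_E:=\inf_{r>0}\overline{\dim}_B(E\cap B(x,r))$; it is $0$ if $x\notin\overline E$. Directional contribution: for $v\in\mathrm{Eff}_x(A)$, $\theta_x^A(v):=\sup_{\gamma\in\mathcal G_x^A(v)}\dim_{\mathrm{Pbox}}\{x\}_{A\cap\Gamma_\gamma}$; for $\xi\in\mathrm{Eff}_x^{\mathbb P}(A)$, $\theta_x^A(\xi):=\sup\{\theta_x^A(w):w\in\mathrm{Eff}_x(A),[w]=\xi\}$.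 Point-Cross dimension at $x\in\overline A$: $\dim_\times\{x\}_A:=\sup\sum_{i=1}^m\theta_x^A(\xi_i)$ over all $m\in\{0,\dots,n\}$ and all $\xi_1,\dots,\xi_m\in\mathrm{Eff}_x^{\mathbb P}(A)$ that are projectively (linearly) independent, i.e. nonzero representatives are linearly independent (empty family allowed, with sum $0$). Global versions $\dim_{\mathrm{Pvec}}(A)$, $\dim_\times(A)$, $\dim_{\mathrm{Ptan}}(A)$ are the suprema over $x\in\overline A$ of the pointwise quantities, and equal $0$ if $A=\varnothing$. *)

theory Defs
  imports "HOL-Analysis.Analysis"
begin

text \<open>
  The ambient space is \<open>real ^ 'n\<close>, so that \<open>n = CARD('n) \<ge> 1\<close>.
  Pointwise quantities take the set first and the point second:
  \<open>dim_Pvec A x\<close> is $\dim_{\mathrm{Pvec}}\{x\}_A$.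
  Integer-valued dimensions have type \<open>nat\<close>; those built from box dimensions have
  type \<open>ereal\<close>.
\<close>

definition segments :: "'i set \<Rightarrow> ('i \<Rightarrow> real ^ 'n) \<Rightarrow> ('i \<Rightarrow> real ^ 'n) \<Rightarrow> (real ^ 'n) set set"
  where "segments I a b = (\<lambda>i. closed_segment (a i) (b i)) ` I"

text \<open>
  Two indices carrying the same segment describe the same edge: distinctness of edges and
  local finiteness both refer to the set of segments.
\<close>

definition geometric_graph :: "'i set \<Rightarrow> ('i \<Rightarrow> real ^ 'n) \<Rightarrow> ('i \<Rightarrow> real ^ 'n) \<Rightarrow> bool"
  where "geometric_graph I a b \<longleftrightarrow>
    (\<forall>i\<in>I. a i \<noteq> b i) \<and>
    locally_finite_in euclidean (segments I a b) \<and>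
    (\<forall>i\<in>I. \<forall>j\<in>I. closed_segment (a i) (b i) \<noteq> closed_segment (a j) (b j) \<longrightarrow>
       closed_segment (a i) (b i) \<inter> closed_segment (a j) (b j) = {} \<or>
       (\<exists>p \<in> {a i, b i} \<inter> {a j, b j}.
          closed_segment (a i) (b i) \<inter> closed_segment (a j) (b j) = {p}))"

definition nodes :: "'i set \<Rightarrow> ('i \<Rightarrow> real ^ 'n) \<Rightarrow> ('i \<Rightarrow> real ^ 'n) \<Rightarrow> (real ^ 'n) set"
  where "nodes I a b = (\<Union>i\<in>I. {a i, b i})"

definition edge_directions :: "(real ^ 'n) set \<Rightarrow> real ^ 'n \<Rightarrow> (real ^ 'n) set"
  where "edge_directions G x =
    {u. norm u = 1 \<and> (\<exists>\<delta>>0. {x + t *\<^sub>R u | t. 0 < t \<and> t < \<delta>} \<subseteq> G)}"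

text \<open>Linear independence of the finite family $v_1,\dots,v_k$, hence the injectivity.\<close>

definition lin_indep_family :: "nat \<Rightarrow> (nat \<Rightarrow> real ^ 'n) \<Rightarrow> bool"
  where "lin_indep_family k v \<longleftrightarrow> inj_on v {1..k} \<and> independent (v ` {1..k})"

definition Pvec_witness :: "(real ^ 'n) set \<Rightarrow> real ^ 'n \<Rightarrow> nat \<Rightarrow> bool"
  where "Pvec_witness A x k \<longleftrightarrow>
    (\<exists>v. \<exists>\<delta>>0. lin_indep_family k v \<and>
       (\<forall>i\<in>{1..k}. {x + t *\<^sub>R v i | t. 0 < t \<and> t < \<delta>} \<subseteq> A))"

definition dim_Pvec :: "(real ^ 'n) set \<Rightarrow> real ^ 'n \<Rightarrow> nat"
  where "dim_Pvec A x =
    (if \<exists>k\<in>{1..CARD('n)}. Pvec_witness A x k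
     then Max {k \<in> {1..CARD('n)}. Pvec_witness A x k} else 0)"

definition tangent_cone :: "(real ^ 'n) set \<Rightarrow> real ^ 'n \<Rightarrow> (real ^ 'n) set"
  where "tangent_cone A x =
    {v. \<exists>y l. (\<forall>k::nat. y k \<in> A) \<and> y \<longlonglongrightarrow> x \<and>
          (\<forall>k. (l k :: real) > 0) \<and> decseq l \<and> l \<longlonglongrightarrow> 0 \<and>
          (\<lambda>k. (y k - x) /\<^sub>R l k) \<longlonglongrightarrow> v}"

definition dim_Ptan :: "(real ^ 'n) set \<Rightarrow> real ^ 'n \<Rightarrow> nat"
  where "dim_Ptan A x = dim (span (tangent_cone A x))"

definition effective_directions :: "(real ^ 'n) set \<Rightarrow> real ^ 'n \<Rightarrow> (real ^ 'n) set"
  where "effective_directions A x =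
    (if x \<in> closure A then tangent_cone A x \<inter> sphere 0 1 else {})"

text \<open>A point of projective space is represented by the line it stands for.\<close>

definition proj_point :: "real ^ 'n \<Rightarrow> (real ^ 'n) set"
  where "proj_point v = range (\<lambda>c. c *\<^sub>R v)"

definition proj_effective_directions :: "(real ^ 'n) set \<Rightarrow> real ^ 'n \<Rightarrow> (real ^ 'n) set set"
  where "proj_effective_directions A x = proj_point ` effective_directions A x"

text \<open>
  A probe $\gamma:[0,\delta]\to\mathbb{R}^n$ is the pair of \<open>\<delta>\<close> and a total function of which
  only the values on \<open>{0..\<delta>}\<close> are used.
\<close>

definition probes :: "(real ^ 'n) set \<Rightarrow> real ^ 'n \<Rightarrow> real ^ 'n \<Rightarrow> (real \<times> (real \<Rightarrow> real ^ 'n)) set"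
  where "probes A x v =
    {(\<delta>, \<gamma>). \<delta> > 0 \<and> inj_on \<gamma> {0..\<delta>} \<and> (\<exists>L. L-lipschitz_on {0..\<delta>} \<gamma>) \<and> \<gamma> 0 = x \<and>
       ((\<lambda>t. (\<gamma> t - x) /\<^sub>R norm (\<gamma> t - x)) \<longlongrightarrow> v) (at_right 0) \<and>
       (\<forall>\<eta>\<in>{0<..\<delta>}. A \<inter> \<gamma> ` {0<..\<eta>} \<noteq> {})}"

text \<open>
  \<open>bounded S\<close> is needed because \<open>diameter\<close> is unspecified on unbounded sets.
  For bounded \<open>E\<close> and \<open>\<epsilon> > 0\<close> the set of cardinalities is nonempty.
\<close>

definition covering_number :: "real \<Rightarrow> (real ^ 'n) set \<Rightarrow> nat"
  where "covering_number \<epsilon> E =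
    Inf {card \<C> | \<C>. finite \<C> \<and> (\<forall>S\<in>\<C>. bounded S \<and> diameter S \<le> \<epsilon>) \<and> E \<subseteq> \<Union>\<C>}"

definition upper_box_dim :: "(real ^ 'n) set \<Rightarrow> ereal"
  where "upper_box_dim E =
    Limsup (at_right 0) (\<lambda>\<epsilon>. ereal (ln (real (covering_number \<epsilon> E)) / ln (1 / \<epsilon>)))"

definition dim_Pbox :: "(real ^ 'n) set \<Rightarrow> real ^ 'n \<Rightarrow> ereal"
  where "dim_Pbox E x =
    (if x \<in> closure E then INF r\<in>{0<..}. upper_box_dim (E \<inter> ball x r) else 0)"

text \<open>
  The suprema in the next two definitions are only used for \<open>v \<in> effective_directions A x\<close> and
  \<open>\<xi> \<in> proj_effective_directions A x\<close>. There they range over nonempty families of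
  nonnegative values (a polygon through a fast subsequence of points of \<open>A\<close> tending to \<open>x\<close> in
  direction \<open>v\<close> is a probe), so that \<open>Sup {} = -\<infinity>\<close> does not interfere.
\<close>

definition dir_contribution :: "(real ^ 'n) set \<Rightarrow> real ^ 'n \<Rightarrow> real ^ 'n \<Rightarrow> ereal"
  where "dir_contribution A x v =
    (SUP (\<delta>, \<gamma>) \<in> probes A x v. dim_Pbox (A \<inter> \<gamma> ` {0..\<delta>}) x)"

definition proj_contribution :: "(real ^ 'n) set \<Rightarrow> real ^ 'n \<Rightarrow> (real ^ 'n) set \<Rightarrow> ereal"
  where "proj_contribution A x \<xi> =
    Sup {dir_contribution A x w | w. w \<in> effective_directions A x \<and> proj_point w = \<xi>}"

definition proj_independent :: "nat \<Rightarrow> (nat \<Rightarrow> (real ^ 'n) set) \<Rightarrow> bool"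
  where "proj_independent m \<xi> \<longleftrightarrow>
    (\<exists>w. (\<forall>i\<in>{1..m}. w i \<noteq> 0 \<and> proj_point (w i) = \<xi> i) \<and> lin_indep_family m w)"

definition dim_cross :: "(real ^ 'n) set \<Rightarrow> real ^ 'n \<Rightarrow> ereal"
  where "dim_cross A x =
    Sup {\<Sum>i = 1..m. proj_contribution A x (\<xi> i) | m \<xi>.
           m \<le> CARD('n) \<and> (\<forall>i\<in>{1..m}. \<xi> i \<in> proj_effective_directions A x) \<and>
           proj_independent m \<xi>}"

text \<open>The suprema over \<open>nat\<close> below are over sets bounded by \<open>CARD('n)\<close>.\<close>

definition global_dim_Pvec :: "(real ^ 'n) set \<Rightarrow> nat"
  where "global_dim_Pvec A = (if A = {} then 0 else SUP x\<in>closure A. dim_Pvec A x)"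

definition global_dim_Ptan :: "(real ^ 'n) set \<Rightarrow> nat"
  where "global_dim_Ptan A = (if A = {} then 0 else SUP x\<in>closure A. dim_Ptan A x)"

definition global_dim_cross :: "(real ^ 'n) set \<Rightarrow> ereal"
  where "global_dim_cross A = (if A = {} then 0 else SUP x\<in>closure A. dim_cross A x)"

end

theory Submission
  imports Defs "HOL-Real_Asymp.Real_Asymp"
begin

text \<open>
  By local finiteness, the graph coincides near each of its points \<open>x\<close> with the finite fan of
  segments \<open>x + t u\<close>, $0 \le t < r$, where \<open>u\<close> runs through the incident unit directions \<open>D\<close>.
  For such a fan the directions realised by segments, the nonzero tangent directions and the
  effective directions are all given by \<open>D\<close>. Every directional contribution is 1: a finite
  union of segments has box dimension at most 1, and the straight probe attains this value.
  Hence all three dimensions equal the rank of \<open>D\<close>. Outside the nodes this rank is at most 1,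
  and it is at least 1 everywhere, so the suprema are attained at nodes.
\<close>

section \<open>Normalised vectors and linearly independent families\<close>

lemma sgn_scaleR_pos: "c > 0 \<Longrightarrow> sgn (c *\<^sub>R v) = sgn (v :: 'a::real_normed_vector)"
  by (simp add: sgn_scaleR)

lemma sgn_eq_self: "norm u = 1 \<Longrightarrow> sgn u = (u :: 'a::real_normed_vector)"
  by (simp add: sgn_div_norm)

lemma norm_scaleR_sgn: "norm v *\<^sub>R sgn v = (v :: 'a::real_normed_vector)"
  by (cases "v = 0") (simp_all add: sgn_div_norm)

lemma lin_indep_family_nonzero:
  assumes "lin_indep_family k v" "i \<in> {1..k}"
  shows "v i \<noteq> 0"
  using assms dependent_zero unfolding lin_indep_family_def by (metis imageI)

lemma lin_indep_family_le_dim: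
  assumes "lin_indep_family k v" "\<And>i. i \<in> {1..k} \<Longrightarrow> v i \<in> span D"
  shows "k \<le> dim (span D)"
proof -
  have "card (v ` {1..k}) = k"
    using assms(1) by (simp add: lin_indep_family_def card_image)
  moreover have "card (v ` {1..k}) \<le> dim (span D)"
    using assms by (intro independent_card_le_dim) (auto simp: lin_indep_family_def)
  ultimately show ?thesis by simp
qed

text \<open>A basis of the span can be chosen inside \<open>D\<close> itself. Its enumeration from 1
  is the family that attains both the point-vector and the Point-Cross dimension.\<close>

lemma lin_indep_family_exists:
  fixes D :: "(real ^ 'n) set"
  obtains v where "lin_indep_family (dim (span D)) v" "v ` {1..dim (span D)} \<subseteq> D"
proof -
  obtain B where B: "B \<subseteq> D" "independent B" "card B = dim D"
    using basis_exists[of D] by metis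
  obtain v where "bij_betw v {1..card B} B"
    using ex_bij_betw_nat_finite_1[OF independent_imp_finite[OF B(2)]] by blast
  with B that[of v] show ?thesis
    by (simp add: lin_indep_family_def bij_betw_def)
qed

lemma dim_span_le_CARD: "dim (span (D :: (real ^ 'n) set)) \<le> CARD('n)"
  by (metis DIM_cart DIM_real dim_subset_UNIV mult.right_neutral)


section \<open>Box dimension of finite unions of segments\<close>

lemma covering_number_le:
  assumes "finite \<C>" "\<And>S. S \<in> \<C> \<Longrightarrow> bounded S \<and> diameter S \<le> \<epsilon>" "E \<subseteq> \<Union>\<C>"
  shows "covering_number \<epsilon> E \<le> card \<C>"
  unfolding covering_number_def by (rule cInf_lower) (use assms in auto)

text \<open>A nonempty set of naturals contains its infimum. The given finite cover guarantees
  nonemptiness, so lower bounds on covers become lower bounds on the covering number.\<close>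

lemma covering_number_attained:
  assumes "finite \<C>" "\<And>S. S \<in> \<C> \<Longrightarrow> bounded S \<and> diameter S \<le> \<epsilon>" "E \<subseteq> \<Union>\<C>"
  obtains \<C>' where "finite \<C>'" "\<And>S. S \<in> \<C>' \<Longrightarrow> bounded S \<and> diameter S \<le> \<epsilon>" "E \<subseteq> \<Union>\<C>'"
    "card \<C>' = covering_number \<epsilon> E"
proof -
  let ?K = "{card \<C> | \<C>. finite \<C> \<and> (\<forall>S\<in>\<C>. bounded S \<and> diameter S \<le> \<epsilon>) \<and> E \<subseteq> \<Union>\<C>}"
  have "card \<C> \<in> ?K" using assms by blast
  then have "Inf ?K \<in> ?K" by (intro Inf_nat_def1) blast
  then show ?thesis unfolding covering_number_def[symmetric] mem_Collect_eq
    by (elim exE conjE) (rule that, auto)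
qed

text \<open>A segment is the convex hull of its endpoints, and the distance between two points of a
  simplex is at most that between some two vertices.\<close>

lemma diameter_closed_segment:
  fixes p q :: "'a::euclidean_space"
  shows "diameter (closed_segment p q) = dist p q"
proof (rule antisym)
  show "diameter (closed_segment p q) \<le> dist p q"
  proof (rule diameter_le)
    fix y z assume "y \<in> closed_segment p q" "z \<in> closed_segment p q"
    then show "norm (y - z) \<le> dist p q"
      using simplex_extremal_le_exists[of "{p, q}" y z]
      by (auto simp: segment_convex_hull dist_norm norm_minus_commute)
  qed simp
  show "dist p q \<le> diameter (closed_segment p q)"
    by (intro diameter_bounded_bound bounded_closed_segment) auto
qed

text \<open>Each segment of length \<open>\<rho>\<close> is chopped into pieces of length exactly
  \<open>\<epsilon>\<close>, so the number of pieces grows only linearly in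
  \<open>1 / \<epsilon>\<close>.\<close>

lemma ray_segments_cover:
  fixes x :: "real ^ 'n"
  assumes "finite D" "D \<subseteq> sphere 0 1" "\<rho> > 0" "\<epsilon> > 0"
    and E: "E \<subseteq> {x + t *\<^sub>R u | t u. 0 \<le> t \<and> t \<le> \<rho> \<and> u \<in> D}"
  obtains \<C> where "finite \<C>" "\<And>S. S \<in> \<C> \<Longrightarrow> bounded S \<and> diameter S \<le> \<epsilon>" "E \<subseteq> \<Union>\<C>"
    "real (card \<C>) \<le> real (card D) * (\<rho> / \<epsilon> + 1)"
proof -
  \<comment> \<open>The pieces are numbered from 0 to \<open>m\<close>, hence \<open>Suc m\<close>
    per direction; the last one may overshoot \<open>\<rho>\<close>.\<close>
  define m where "m = nat \<lfloor>\<rho> / \<epsilon>\<rfloor>"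
  define seg where "seg = (\<lambda>(u :: real ^ 'n, i :: nat).
    closed_segment (x + (real i * \<epsilon>) *\<^sub>R u) (x + (real (Suc i) * \<epsilon>) *\<^sub>R u))"
  define \<C> where "\<C> = seg ` (D \<times> {0..m})"
  show ?thesis
  proof
    show "finite \<C>" unfolding \<C>_def using assms(1) by simp
    show "bounded S \<and> diameter S \<le> \<epsilon>" if S: "S \<in> \<C>" for S
    proof -
      obtain u i where u: "u \<in> D" "S = seg (u, i)" using S unfolding \<C>_def by auto
      then have "norm u = 1" using assms(2) by auto
      moreover have "(x + (real i * \<epsilon>) *\<^sub>R u) - (x + (real (Suc i) * \<epsilon>) *\<^sub>R u) = - (\<epsilon> *\<^sub>R u)"
        by (simp add: algebra_simps)
      ultimately have "dist (x + (real i * \<epsilon>) *\<^sub>R u) (x + (real (Suc i) * \<epsilon>) *\<^sub>R u) = \<epsilon>"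
        unfolding dist_norm using assms(4) by simp
      then show ?thesis
        unfolding u(2) seg_def by (simp add: diameter_closed_segment bounded_closed_segment)
    qed
    show "E \<subseteq> \<Union>\<C>"
    proof
      fix y assume "y \<in> E"
      then obtain t u where y: "y = x + t *\<^sub>R u" "0 \<le> t" "t \<le> \<rho>" "u \<in> D" using E by blast
      define i where "i = nat \<lfloor>t / \<epsilon>\<rfloor>"
      have i: "real i = of_int \<lfloor>t / \<epsilon>\<rfloor>" using y(2) assms(4) by (simp add: i_def)
      have "i \<le> m" unfolding i_def m_def
        using y(3) assms(4) by (intro nat_mono floor_mono divide_right_mono) auto
      moreover have "y \<in> seg (u, i)"
      proof -
        \<comment> \<open>The fractional part of \<open>t / \<epsilon>\<close> is the convex
          parameter of \<open>y\<close> within piece \<open>i\<close>.\<close>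
        define s where "s = t / \<epsilon> - real i"
        have s: "0 \<le> s" "s \<le> 1" unfolding s_def i by linarith+
        have t: "t = (real i + s) * \<epsilon>" unfolding s_def using assms(4) by simp
        show ?thesis unfolding seg_def prod.case in_segment
          using s by (intro exI[of _ s]) (simp add: y(1) t algebra_simps)
      qed
      ultimately show "y \<in> \<Union>\<C>" using y(4) unfolding \<C>_def
        by (intro UnionI[of "seg (u, i)"] imageI) auto
    qed
    have "card \<C> \<le> card D * Suc m"
      unfolding \<C>_def using card_image_le[of "D \<times> {0..m}" seg] assms(1) by simp
    then have "real (card \<C>) \<le> real (card D * Suc m)"
      using of_nat_le_iff by blast
    also have "\<dots> = real (card D) * (real m + 1)" by (simp add: algebra_simps)
    also have "real m \<le> \<rho> / \<epsilon>" unfolding m_def using assms(3,4) by simp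
    finally show "real (card \<C>) \<le> real (card D) * (\<rho> / \<epsilon> + 1)"
      by (simp add: mult_left_mono)
  qed
qed

text \<open>The points $x + 2i\varepsilon u$ lie in pairwise different members of a cover.\<close>

lemma card_cover_segment_ge:
  fixes x :: "real ^ 'n"
  assumes "norm u = 1" "\<epsilon> > 0" "L > 0" "finite \<C>"
    and C: "\<And>S. S \<in> \<C> \<Longrightarrow> bounded S \<and> diameter S \<le> \<epsilon>"
    and E: "{x + t *\<^sub>R u | t. 0 \<le> t \<and> t < L} \<subseteq> \<Union>\<C>"
  shows "L / (2 * \<epsilon>) \<le> real (card \<C>)"
proof -
  \<comment> \<open>Rounding up serves both ends: \<open>i < m\<close> gives
    \<open>real i < L / (2 * \<epsilon>)\<close>, which keeps \<open>p i\<close> on the half-open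
    segment, and \<open>m\<close> is at least \<open>L / (2 * \<epsilon>)\<close>.\<close>
  define m where "m = nat \<lceil>L / (2 * \<epsilon>)\<rceil>"
  define p where "p = (\<lambda>i :: nat. x + (2 * \<epsilon> * real i) *\<^sub>R u)"
  have "\<exists>S\<in>\<C>. p i \<in> S" if "i < m" for i
  proof -
    have "real i < L / (2 * \<epsilon>)" using that unfolding m_def by linarith
    then have "2 * \<epsilon> * real i < L" using assms(2) by (simp add: field_simps)
    then have "p i \<in> {x + t *\<^sub>R u | t. 0 \<le> t \<and> t < L}"
      unfolding p_def using assms(2) by (intro CollectI exI[of _ "2 * \<epsilon> * real i"]) simp
    then show ?thesis using E by blast
  qed
  then obtain f where f: "\<And>i. i < m \<Longrightarrow> f i \<in> \<C> \<and> p i \<in> f i" by metis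
  have "inj_on f {..<m}"
  proof (rule inj_onI)
    fix i j assume ij: "i \<in> {..<m}" "j \<in> {..<m}" "f i = f j"
    then have "dist (p i) (p j) \<le> \<epsilon>"
      using f[of i] f[of j] C[of "f i"] diameter_bounded_bound[of "f i" "p i" "p j"]
      by force
    moreover have "dist (p i) (p j) = 2 * \<epsilon> * \<bar>real i - real j\<bar>"
      using assms(1,2) unfolding p_def dist_norm
      by (simp add: abs_mult flip: scaleR_diff_left right_diff_distrib)
    \<comment> \<open>Points in a common member have indices at most 1/2 apart, and distinct
      integers differ by at least 1.\<close>
    ultimately have "\<bar>real i - real j\<bar> < 1" using assms(2) by (simp add: field_simps)
    then show "i = j" by linarith
  qed
  then have "m \<le> card \<C>"
    using card_inj_on_le[of f "{..<m}" \<C>] f assms(4) by auto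
  then show ?thesis unfolding m_def by linarith
qed

text \<open>The numerator is \<open>ln c + ln (1 / \<epsilon>)\<close> and its second term tends to
  infinity. Constant factors in covering bounds therefore do not affect the box dimension.\<close>

lemma tendsto_ln_ratio:
  fixes c :: real
  assumes "c > 0"
  shows "((\<lambda>\<epsilon>. ereal (ln (c / \<epsilon>) / ln (1 / \<epsilon>))) \<longlongrightarrow> 1) (at_right 0)"
proof -
  have "((\<lambda>\<epsilon>::real. ln (c / \<epsilon>) / ln (1 / \<epsilon>)) \<longlongrightarrow> 1) (at_right 0)"
    using assms by real_asymp
  then show ?thesis by (simp add: one_ereal_def)
qed

lemma upper_box_dim_le_1:
  fixes x :: "real ^ 'n"
  assumes "finite D" "D \<subseteq> sphere 0 1" "\<rho> > 0"
    and E: "E \<subseteq> {x + t *\<^sub>R u | t u. 0 \<le> t \<and> t \<le> \<rho> \<and> u \<in> D}"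
  shows "upper_box_dim E \<le> 1"
proof -
  \<comment> \<open>With \<open>\<epsilon> < 1\<close>, the summand in \<open>\<rho> + 1\<close>
    absorbs the additive 1 of the cover bound. The other summand keeps \<open>c > 1\<close> even for
    empty \<open>D\<close>.\<close>
  define c where "c = (real (card D) + 1) * (\<rho> + 1)"
  have c: "c > 1" using assms(3) unfolding c_def by (simp add: algebra_simps add_pos_nonneg)
  have "eventually (\<lambda>\<epsilon>. ereal (ln (real (covering_number \<epsilon> E)) / ln (1 / \<epsilon>))
      \<le> ereal (ln (c / \<epsilon>) / ln (1 / \<epsilon>))) (at_right 0)"
    unfolding eventually_at_right_field
  \<comment> \<open>For \<open>\<epsilon> < 1\<close> the denominator
    \<open>ln (1 / \<epsilon>)\<close> is positive, so it suffices to compare the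
    numerators.\<close>
  proof (intro exI[of _ 1] conjI allI impI)
    fix \<epsilon> :: real assume eps: "0 < \<epsilon>" "\<epsilon> < 1"
    obtain \<C> where \<C>: "finite \<C>" "\<And>S. S \<in> \<C> \<Longrightarrow> bounded S \<and> diameter S \<le> \<epsilon>" "E \<subseteq> \<Union>\<C>"
      "real (card \<C>) \<le> real (card D) * (\<rho> / \<epsilon> + 1)"
      using ray_segments_cover[OF assms(1-3) eps(1) E] by blast
    have "real (covering_number \<epsilon> E) \<le> real (card D) * (\<rho> / \<epsilon> + 1)"
      using covering_number_le[OF \<C>(1-3)] \<C>(4) by linarith
    also have "\<dots> \<le> (real (card D) + 1) * ((\<rho> + 1) / \<epsilon>)"
      using eps assms(3) by (intro mult_mono) (auto simp: field_simps)
    finally have N: "real (covering_number \<epsilon> E) \<le> c / \<epsilon>" unfolding c_def by simp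
    have "ln (real (covering_number \<epsilon> E)) \<le> ln (c / \<epsilon>)"
    proof (cases "covering_number \<epsilon> E = 0")
      \<comment> \<open>This happens for empty \<open>E\<close>. Here \<open>ln 0 = 0\<close>, while
        \<open>c / \<epsilon> > 1\<close> makes the right-hand side nonnegative.\<close>
      case True
      then show ?thesis using c eps by (simp add: ln_ge_zero field_simps)
    next
      case False
      then show ?thesis using N by (intro ln_mono) auto
    qed
    then show "ereal (ln (real (covering_number \<epsilon> E)) / ln (1 / \<epsilon>))
      \<le> ereal (ln (c / \<epsilon>) / ln (1 / \<epsilon>))"
      using eps by (simp add: divide_right_mono)
  qed simp
  then have "upper_box_dim E \<le> Limsup (at_right 0) (\<lambda>\<epsilon>. ereal (ln (c / \<epsilon>) / ln (1 / \<epsilon>)))"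
    unfolding upper_box_dim_def by (rule Limsup_mono)
  also have "\<dots> = 1"
    using c by (intro lim_imp_Limsup tendsto_ln_ratio) auto
  finally show ?thesis .
qed

text \<open>The enclosing fan supplies a finite cover, so the covering number is attained; an
  attaining cover also covers the contained segment and has at least
  \<open>L / (2 * \<epsilon>)\<close> members.\<close>

lemma upper_box_dim_ge_1:
  fixes x :: "real ^ 'n"
  assumes "finite D" "D \<subseteq> sphere 0 1" "\<rho> > 0"
    and E: "E \<subseteq> {x + t *\<^sub>R u | t u. 0 \<le> t \<and> t \<le> \<rho> \<and> u \<in> D}"
    and u: "norm u = 1" and L: "L > 0" and uE: "{x + t *\<^sub>R u | t. 0 \<le> t \<and> t < L} \<subseteq> E"
  shows "upper_box_dim E \<ge> 1"
proof -
  have "1 = Limsup (at_right 0) (\<lambda>\<epsilon>. ereal (ln (L / 2 / \<epsilon>) / ln (1 / \<epsilon>)))"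
    using L by (intro lim_imp_Limsup[symmetric] tendsto_ln_ratio) auto
  also have "\<dots> \<le> upper_box_dim E" unfolding upper_box_dim_def
  proof (rule Limsup_mono, unfold eventually_at_right_field, intro exI[of _ 1] conjI allI impI)
    fix \<epsilon> :: real assume eps: "0 < \<epsilon>" "\<epsilon> < 1"
    obtain \<C> where \<C>: "finite \<C>" "\<And>S. S \<in> \<C> \<Longrightarrow> bounded S \<and> diameter S \<le> \<epsilon>" "E \<subseteq> \<Union>\<C>"
      "real (card \<C>) \<le> real (card D) * (\<rho> / \<epsilon> + 1)"
      using ray_segments_cover[OF assms(1-3) eps(1) E] by blast
    obtain \<C>' where \<C>': "finite \<C>'" "\<And>S. S \<in> \<C>' \<Longrightarrow> bounded S \<and> diameter S \<le> \<epsilon>" "E \<subseteq> \<Union>\<C>'"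
      "card \<C>' = covering_number \<epsilon> E"
      using covering_number_attained[OF \<C>(1-3)] by blast
    have "L / (2 * \<epsilon>) \<le> real (covering_number \<epsilon> E)"
      using card_cover_segment_ge[OF u eps(1) L \<C>'(1,2) order_trans[OF uE \<C>'(3)]] \<C>'(4) by simp
    then have "ln (L / 2 / \<epsilon>) \<le> ln (real (covering_number \<epsilon> E))"
      using L eps by (intro ln_mono) (auto simp: field_simps)
    then show "ereal (ln (L / 2 / \<epsilon>) / ln (1 / \<epsilon>))
      \<le> ereal (ln (real (covering_number \<epsilon> E)) / ln (1 / \<epsilon>))"
      using eps by (simp add: divide_right_mono)
  qed simp
  finally show ?thesis .
qed


section \<open>Sets that are finite fans of segments near a point\<close>

text \<open>A fan in polar form: near \<open>x\<close>, membership depends only on the direction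
  \<open>sgn (y - x)\<close>. Edge lengths disappear once \<open>r\<close> is small, and nonempty
  \<open>D\<close> excludes isolated points.\<close>

locale local_fan =
  fixes A :: "(real ^ 'n) set" and x :: "real ^ 'n" and D :: "(real ^ 'n) set" and r :: real
  assumes finite_D: "finite D" and D_nonempty: "D \<noteq> {}" and D_unit: "D \<subseteq> sphere 0 1"
    and r_pos: "r > 0" and x_in: "x \<in> A"
    and mem_iff: "\<And>y. y \<noteq> x \<Longrightarrow> dist y x < r \<Longrightarrow> y \<in> A \<longleftrightarrow> sgn (y - x) \<in> D"
begin

lemma D_norm: "u \<in> D \<Longrightarrow> norm u = 1"
  using D_unit by auto

lemma D_sgn: "u \<in> D \<Longrightarrow> sgn u = u"
  by (simp add: D_norm sgn_eq_self)

lemma ray_mem_iff: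
  assumes "v \<noteq> 0" "0 < t" "t * norm v < r"
  shows "x + t *\<^sub>R v \<in> A \<longleftrightarrow> sgn v \<in> D"
  using mem_iff[of "x + t *\<^sub>R v"] assms by (simp add: dist_norm sgn_scaleR_pos)

lemma ray_subset_iff:
  assumes "v \<noteq> 0"
  shows "(\<exists>\<delta>>0. {x + t *\<^sub>R v | t. 0 < t \<and> t < \<delta>} \<subseteq> A) \<longleftrightarrow> sgn v \<in> D"
proof
  assume "\<exists>\<delta>>0. {x + t *\<^sub>R v | t. 0 < t \<and> t < \<delta>} \<subseteq> A"
  then obtain \<delta> where \<delta>: "\<delta> > 0" "{x + t *\<^sub>R v | t. 0 < t \<and> t < \<delta>} \<subseteq> A" by blast
  \<comment> \<open>A parameter below both bounds gives a point that lies on the given segment and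
    within distance \<open>r\<close> of \<open>x\<close>; this single point already determines the
    direction.\<close>
  have m: "0 < min \<delta> (r / norm v)" using \<delta>(1) r_pos assms by simp
  then obtain t where "0 < t" "t < min \<delta> (r / norm v)" using dense by blast
  then have "0 < t" "t < \<delta>" "t < r / norm v" by simp_all
  then show "sgn v \<in> D"
    using \<delta>(2) ray_mem_iff[of v t] assms by (auto simp: field_simps)
next
  assume "sgn v \<in> D"
  then show "\<exists>\<delta>>0. {x + t *\<^sub>R v | t. 0 < t \<and> t < \<delta>} \<subseteq> A"
    using assms r_pos by (intro exI[of _ "r / norm v"]) (auto simp: ray_mem_iff field_simps)
qed

section \<open>Segments issuing from the centre and the point-vector dimension\<close>

lemma edge_directions_eq: "edge_directions A x = D"
proof -
  have "u \<in> edge_directions A x \<longleftrightarrow> u \<in> D" for u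
  proof (cases "norm u = 1")
    case True
    then have "u \<noteq> 0" by auto
    then show ?thesis
      using ray_subset_iff[of u] True by (simp add: edge_directions_def sgn_eq_self)
  qed (auto simp: edge_directions_def D_norm)
  then show ?thesis by blast
qed

lemma sgn_in_D_imp_span: "sgn v \<in> D \<Longrightarrow> v \<in> span D"
  by (metis norm_scaleR_sgn span_base span_scale)

text \<open>Places the rank in the range \<open>{1..CARD('n)}\<close> over which
  \<open>dim_Pvec\<close> maximises, and later lets nodes dominate non-nodes.\<close>

lemma dim_span_pos: "dim (span D) \<ge> 1"
proof -
  obtain u where "u \<in> D" using D_nonempty by blast
  then have "u \<in> D" "u \<noteq> 0" using D_norm by force+
  then have "\<not> D \<subseteq> {0}" by blast
  then have "dim D \<noteq> 0" using dim_eq_0 by blast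
  then show ?thesis unfolding dim_span by linarith
qed

lemma Pvec_witness_le:
  assumes "Pvec_witness A x k"
  shows "k \<le> dim (span D)"
proof -
  obtain v \<delta> where v: "\<delta> > 0" "lin_indep_family k v"
    "\<And>i. i \<in> {1..k} \<Longrightarrow> {x + t *\<^sub>R v i | t. 0 < t \<and> t < \<delta>} \<subseteq> A"
    using assms unfolding Pvec_witness_def by blast
  have "v i \<in> span D" if "i \<in> {1..k}" for i
    using ray_subset_iff lin_indep_family_nonzero[OF v(2) that] v(1) v(3)[OF that]
      sgn_in_D_imp_span by blast
  then show ?thesis by (rule lin_indep_family_le_dim[OF v(2)])
qed

lemma Pvec_witness_dim: "Pvec_witness A x (dim (span D))"
proof -
  obtain v where v: "lin_indep_family (dim (span D)) v" "v ` {1..dim (span D)} \<subseteq> D"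
    by (rule lin_indep_family_exists)
  have "{x + t *\<^sub>R v i | t. 0 < t \<and> t < r} \<subseteq> A" if "i \<in> {1..dim (span D)}" for i
  proof -
    have "v i \<in> D" using v(2) that by blast
    moreover from this have "v i \<noteq> 0" using D_norm by force
    ultimately show ?thesis using ray_mem_iff D_norm D_sgn by auto
  qed
  then show ?thesis unfolding Pvec_witness_def using v(1) r_pos by blast
qed

lemma dim_Pvec_eq: "dim_Pvec A x = dim (span D)"
proof -
  have d: "dim (span D) \<in> {k \<in> {1..CARD('n)}. Pvec_witness A x k}"
    using dim_span_pos Pvec_witness_dim dim_span_le_CARD[of D] by simp
  then have "Max {k \<in> {1..CARD('n)}. Pvec_witness A x k} = dim (span D)"
    by (intro Max_eqI) (auto dest: Pvec_witness_le)
  then show ?thesis using d unfolding dim_Pvec_def by auto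
qed

section \<open>The tangent cone and the effective directions\<close>

text \<open>Directions of secants near \<open>x\<close> lie in the finite, hence closed, set
  \<open>D\<close>, and \<open>sgn\<close> is continuous away from 0. Conversely, points on the ray
  itself realise \<open>v\<close>.\<close>

lemma tangent_cone_iff:
  assumes "v \<noteq> 0"
  shows "v \<in> tangent_cone A x \<longleftrightarrow> sgn v \<in> D"
proof
  assume "v \<in> tangent_cone A x"
  then obtain y l where y: "\<And>k::nat. y k \<in> A" "y \<longlonglongrightarrow> x" "\<And>k. (l k :: real) > 0"
    "(\<lambda>k. (y k - x) /\<^sub>R l k) \<longlonglongrightarrow> v"
    unfolding tangent_cone_def by blast
  have "eventually (\<lambda>k. dist (y k) x < r) sequentially"
    using y(2) r_pos by (simp add: tendsto_iff)
  \<comment> \<open>Since \<open>v\<close> is nonzero, eventually \<open>y k\<close> differs from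
    \<open>x\<close>, as \<open>mem_iff\<close> requires.\<close>
  moreover have "eventually (\<lambda>k. (y k - x) /\<^sub>R l k \<noteq> 0) sequentially"
    using y(4) assms by (rule tendsto_imp_eventually_ne)
  ultimately have "eventually (\<lambda>k. sgn ((y k - x) /\<^sub>R l k) \<in> D) sequentially"
  proof eventually_elim
    case (elim k)
    then show ?case using mem_iff[of "y k"] y(1)[of k] y(3)[of k]
      by (auto simp: sgn_scaleR_pos)
  qed
  moreover have "closed D" using finite_D by (rule finite_imp_closed)
  moreover have "(\<lambda>k. sgn ((y k - x) /\<^sub>R l k)) \<longlonglongrightarrow> sgn v"
    using y(4) assms by (rule tendsto_sgn)
  ultimately show "sgn v \<in> D"
    by (intro Lim_in_closed_set[OF _ _ trivial_limit_sequentially])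
next
  assume sgn: "sgn v \<in> D"
  \<comment> \<open>The factor keeps all points \<open>x + l k *\<^sub>R v\<close> within distance
    \<open>r / 2\<close> of \<open>x\<close>; the quotients are then constantly
    \<open>v\<close>.\<close>
  define l where "l = (\<lambda>k::nat. r / (2 * norm v) * inverse (real (Suc k)))"
  have pos: "l k > 0" for k unfolding l_def using r_pos assms by simp
  have "l k * norm v < r" for k
  proof -
    have "l k * norm v = r / 2 * inverse (real (Suc k))" unfolding l_def using assms by simp
    also have "\<dots> \<le> r / 2 * 1"
      using r_pos by (intro mult_left_mono) (auto simp: field_simps)
    finally show ?thesis using r_pos by simp
  qed
  then have "x + l k *\<^sub>R v \<in> A" for k using ray_mem_iff[OF assms pos] sgn by blast
  moreover have l0: "l \<longlonglongrightarrow> 0"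
    unfolding l_def by (rule tendsto_mult_right_zero[OF LIMSEQ_inverse_real_of_nat])
  moreover have "(\<lambda>k. x + l k *\<^sub>R v) \<longlonglongrightarrow> x"
    using tendsto_add[OF tendsto_const[of x] tendsto_scaleR[OF l0 tendsto_const[of v]]] by simp
  moreover have "decseq l"
    unfolding decseq_def l_def using r_pos
    by (intro allI impI mult_left_mono le_imp_inverse_le) auto
  moreover have "(\<lambda>k. (x + l k *\<^sub>R v - x) /\<^sub>R l k) \<longlonglongrightarrow> v"
  proof -
    have "(x + l k *\<^sub>R v - x) /\<^sub>R l k = v" for k using pos[of k] by simp
    then show ?thesis by simp
  qed
  ultimately show "v \<in> tangent_cone A x"
    unfolding tangent_cone_def using pos
    by (intro CollectI exI[of _ "\<lambda>k. x + l k *\<^sub>R v"] exI[of _ l]) simp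
qed

text \<open>The cone lies between \<open>D\<close> and \<open>span D\<close>, so it has the same
  span.\<close>

lemma dim_Ptan_eq: "dim_Ptan A x = dim (span D)"
proof -
  have "tangent_cone A x \<subseteq> span D"
  proof
    fix v assume "v \<in> tangent_cone A x"
    then show "v \<in> span D"
      using tangent_cone_iff[of v] sgn_in_D_imp_span[of v] span_zero[of D] by (cases "v = 0") auto
  qed
  moreover have "D \<subseteq> tangent_cone A x"
  proof
    fix u assume u: "u \<in> D"
    then have "u \<noteq> 0" using D_norm by force
    then show "u \<in> tangent_cone A x" using u tangent_cone_iff D_sgn by metis
  qed
  ultimately have "span (tangent_cone A x) = span D"
    by (meson span_mono span_minimal subspace_span subset_antisym)
  then show ?thesis unfolding dim_Ptan_def by simp
qed

lemma effective_directions_eq: "effective_directions A x = D"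
proof -
  have "x \<in> closure A" using x_in closure_subset by blast
  moreover have "tangent_cone A x \<inter> sphere 0 1 = D"
  proof -
    have "u \<in> tangent_cone A x \<longleftrightarrow> u \<in> D" if "norm u = 1" for u
      using that tangent_cone_iff[of u] by (force simp: sgn_eq_self)
    then show ?thesis using D_unit by auto
  qed
  ultimately show ?thesis unfolding effective_directions_def by simp
qed

section \<open>Point-extended box dimension of subsets of a fan\<close>

lemma ball_subset_rays:
  "A \<inter> ball x r \<subseteq> {x + t *\<^sub>R u | t u. 0 \<le> t \<and> t \<le> r \<and> u \<in> D}"
proof
  fix y assume y: "y \<in> A \<inter> ball x r"
  show "y \<in> {x + t *\<^sub>R u | t u. 0 \<le> t \<and> t \<le> r \<and> u \<in> D}"
  proof (cases "y = x")
    case True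
    moreover obtain u where "u \<in> D" using D_nonempty by blast
    ultimately show ?thesis
      using r_pos by (intro CollectI exI[of _ 0] exI[of _ u]) simp
  next
    case False
    then have "sgn (y - x) \<in> D" using mem_iff[of y] y by (simp add: dist_commute)
    moreover have "norm (y - x) \<le> r" using y by (simp add: dist_norm norm_minus_commute)
    moreover have "y = x + norm (y - x) *\<^sub>R sgn (y - x)" by (simp add: norm_scaleR_sgn)
    ultimately show ?thesis using norm_ge_zero by blast
  qed
qed

text \<open>The single radius \<open>r\<close> bounds the infimum; away from the closure of
  \<open>E\<close> the value is 0.\<close>

lemma dim_Pbox_le_1:
  assumes "E \<subseteq> A"
  shows "dim_Pbox E x \<le> 1"
proof -
  have "E \<inter> ball x r \<subseteq> {x + t *\<^sub>R u | t u. 0 \<le> t \<and> t \<le> r \<and> u \<in> D}"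
    using ball_subset_rays assms by blast
  then have "upper_box_dim (E \<inter> ball x r) \<le> 1"
    by (rule upper_box_dim_le_1[OF finite_D D_unit r_pos])
  then have "(INF \<rho>\<in>{0<..}. upper_box_dim (E \<inter> ball x \<rho>)) \<le> 1"
    using r_pos by (intro INF_lower2[of r]) auto
  then show ?thesis unfolding dim_Pbox_def by simp
qed

text \<open>Every ball around \<open>x\<close>, however small, retains an initial segment of length
  \<open>min \<delta> \<rho>\<close>, so no radius brings the infimum below 1.\<close>

lemma dim_Pbox_segment_ge_1:
  assumes u: "u \<in> D" and \<delta>: "0 < \<delta>" "\<delta> < r"
  shows "dim_Pbox (A \<inter> (\<lambda>t. x + t *\<^sub>R u) ` {0..\<delta>}) x \<ge> 1" (is "dim_Pbox ?E x \<ge> 1")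
proof -
  have mem: "x + t *\<^sub>R u \<in> A" if "0 \<le> t" "t \<le> \<delta>" for t
  proof (cases "t = 0")
    case False
    have "u \<noteq> 0" using u D_norm by force
    then show ?thesis using False that u \<delta> ray_mem_iff[of u t] D_norm D_sgn by auto
  qed (simp add: x_in)
  have "x \<in> ?E" using x_in \<delta> by (auto intro!: image_eqI[of _ _ 0])
  then have "x \<in> closure ?E" by (rule subsetD[OF closure_subset])
  moreover have "1 \<le> (INF \<rho>\<in>{0<..}. upper_box_dim (?E \<inter> ball x \<rho>))"
  proof (rule INF_greatest)
    fix \<rho> :: real assume "\<rho> \<in> {0<..}"
    then have \<rho>: "\<rho> > 0" by simp
    show "1 \<le> upper_box_dim (?E \<inter> ball x \<rho>)"
    proof (rule upper_box_dim_ge_1[OF finite_D D_unit \<delta>(1)])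
      show "?E \<inter> ball x \<rho> \<subseteq> {x + t *\<^sub>R u | t u. 0 \<le> t \<and> t \<le> \<delta> \<and> u \<in> D}"
        using u by (auto intro!: exI)
      show "norm u = 1" using u by (rule D_norm)
      show "min \<delta> \<rho> > 0" using \<delta> \<rho> by simp
      show "{x + t *\<^sub>R u | t. 0 \<le> t \<and> t < min \<delta> \<rho>} \<subseteq> ?E \<inter> ball x \<rho>"
        using mem D_norm[OF u] by (auto simp: dist_norm)
    qed
  qed
  ultimately show ?thesis unfolding dim_Pbox_def by simp
qed

section \<open>Probes, directional contributions and the Point-Cross dimension\<close>

lemma straight_probe:
  assumes u: "u \<in> D" and \<delta>: "0 < \<delta>" "\<delta> < r"
  shows "(\<delta>, \<lambda>t. x + t *\<^sub>R u) \<in> probes A x u"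
proof -
  have n: "norm u = 1" using u by (rule D_norm)
  then have u0: "u \<noteq> 0" by auto
  have "1-lipschitz_on {0..\<delta>} (\<lambda>t. x + t *\<^sub>R u)"
    by (rule lipschitz_onI) (auto simp: dist_norm n simp flip: scaleR_diff_left)
  \<comment> \<open>The normalised displacement is constantly \<open>u\<close> for
    \<open>t > 0\<close>.\<close>
  moreover have "((\<lambda>t. (x + t *\<^sub>R u - x) /\<^sub>R norm (x + t *\<^sub>R u - x)) \<longlongrightarrow> u) (at_right 0)"
    by (rule tendsto_eventually)
      (auto simp: eventually_at_right_field n intro!: exI[of _ 1])
  moreover have "A \<inter> (\<lambda>t. x + t *\<^sub>R u) ` {0<..\<eta>} \<noteq> {}" if "\<eta> \<in> {0<..\<delta>}" for \<eta>
    using that ray_mem_iff[of u \<eta>] u0 n \<delta> u D_sgn by fastforce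
  ultimately show ?thesis
    unfolding probes_def using \<delta>(1) u0 by (auto simp: inj_on_def)
qed

text \<open>Whatever the probe, its trace on \<open>A\<close> is a subset of \<open>A\<close> and
  has dimension at most 1. The straight probe of length \<open>r / 2\<close> attains 1.\<close>

lemma dir_contribution_eq:
  assumes "u \<in> D"
  shows "dir_contribution A x u = 1"
proof (rule antisym)
  show "dir_contribution A x u \<le> 1"
    unfolding dir_contribution_def by (rule SUP_least) (auto intro: dim_Pbox_le_1)
  have "1 \<le> dim_Pbox (A \<inter> (\<lambda>t. x + t *\<^sub>R u) ` {0..r/2}) x"
    using assms r_pos by (intro dim_Pbox_segment_ge_1) auto
  also have "\<dots> \<le> dir_contribution A x u"
    unfolding dir_contribution_def
    using straight_probe[OF assms, of "r/2"] r_pos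
    by (intro SUP_upper2[of "(r/2, \<lambda>t. x + t *\<^sub>R u)"]) auto
  finally show "1 \<le> dir_contribution A x u" .
qed

lemma proj_contribution_eq:
  assumes "\<xi> \<in> proj_effective_directions A x"
  shows "proj_contribution A x \<xi> = 1"
proof -
  obtain u where u: "u \<in> D" "proj_point u = \<xi>"
    using assms by (auto simp: proj_effective_directions_def effective_directions_eq)
  \<comment> \<open>Opposite directions \<open>u\<close> and \<open>- u\<close> may both lie in
    \<open>D\<close> and define the same projective point, but each contributes 1, so the supremum
    is over a singleton.\<close>
  have "{dir_contribution A x w | w. w \<in> effective_directions A x \<and> proj_point w = \<xi>} = {1}"
    (is "?S = _")
  proof
    show "?S \<subseteq> {1}" by (auto simp: effective_directions_eq dir_contribution_eq)
    have "dir_contribution A x u \<in> ?S" using u unfolding effective_directions_eq by blast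
    then show "{1} \<subseteq> ?S" by (simp add: dir_contribution_eq u(1))
  qed
  then show ?thesis unfolding proj_contribution_def by simp
qed

lemma sum_proj_contribution_eq:
  assumes "\<And>i. i \<in> {1..m} \<Longrightarrow> \<xi> i \<in> proj_effective_directions A x"
  shows "(\<Sum>i = 1..m. proj_contribution A x (\<xi> i)) = ereal (real m)"
proof -
  have "(\<Sum>i = 1..m. proj_contribution A x (\<xi> i)) = (\<Sum>i = 1..m. ereal 1)"
    using assms by (intro sum.cong) (auto simp: proj_contribution_eq one_ereal_def)
  then show ?thesis by simp
qed

text \<open>Each representative \<open>w i\<close> spans the same line as some element of
  \<open>D\<close>, so an independent family of such lines lifts to one in
  \<open>span D\<close>.\<close>

lemma proj_independent_le_dim:
  assumes "proj_independent m \<xi>" "\<And>i. i \<in> {1..m} \<Longrightarrow> \<xi> i \<in> proj_effective_directions A x"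
  shows "m \<le> dim (span D)"
proof -
  obtain w where w: "\<And>i. i \<in> {1..m} \<Longrightarrow> proj_point (w i) = \<xi> i" "lin_indep_family m w"
    using assms(1) unfolding proj_independent_def by metis
  have "w i \<in> span D" if i: "i \<in> {1..m}" for i
  proof -
    obtain u where u: "u \<in> D" "proj_point u = proj_point (w i)"
      using assms(2)[OF i] w(1)[OF i]
      by (auto simp: proj_effective_directions_def effective_directions_eq)
    have "w i = 1 *\<^sub>R w i" by simp
    then have "w i \<in> proj_point u" unfolding u(2) unfolding proj_point_def by (rule range_eqI)
    then show ?thesis
      using span_scale[OF span_base[OF u(1)]] by (auto simp: proj_point_def)
  qed
  then show ?thesis by (rule lin_indep_family_le_dim[OF w(2)])
qed

text \<open>As every contribution is 1, each admissible sum equals its number of lines. The rank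
  bounds this number, and a basis taken from \<open>D\<close> attains it.\<close>

lemma dim_cross_eq: "dim_cross A x = ereal (real (dim (span D)))"
  unfolding dim_cross_def
proof (rule Sup_eqI)
  fix s assume "s \<in> {\<Sum>i = 1..m. proj_contribution A x (\<xi> i) | m \<xi>.
           m \<le> CARD('n) \<and> (\<forall>i\<in>{1..m}. \<xi> i \<in> proj_effective_directions A x) \<and>
           proj_independent m \<xi>}"
  then show "s \<le> ereal (real (dim (span D)))"
    using sum_proj_contribution_eq proj_independent_le_dim by force
next
  fix B :: ereal
  let ?k = "dim (span D)"
  assume B: "\<And>s. s \<in> {\<Sum>i = 1..m. proj_contribution A x (\<xi> i) | m \<xi>.
           m \<le> CARD('n) \<and> (\<forall>i\<in>{1..m}. \<xi> i \<in> proj_effective_directions A x) \<and>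
           proj_independent m \<xi>} \<Longrightarrow> s \<le> B"
  obtain v where v: "lin_indep_family ?k v" "v ` {1..?k} \<subseteq> D"
    by (rule lin_indep_family_exists)
  define \<xi> where "\<xi> i = proj_point (v i)" for i
  have eff: "\<xi> i \<in> proj_effective_directions A x" if "i \<in> {1..?k}" for i
    unfolding \<xi>_def proj_effective_directions_def effective_directions_eq
    using v(2) that by (blast intro: imageI)
  have "proj_independent ?k \<xi>"
    unfolding proj_independent_def \<xi>_def
    using v(1) lin_indep_family_nonzero by (intro exI[of _ v]) blast
  then have "(\<Sum>i = 1..?k. proj_contribution A x (\<xi> i)) \<le> B"
    using eff dim_span_le_CARD[of D] by (intro B) blast
  then show "ereal (real ?k) \<le> B" using sum_proj_contribution_eq[of ?k \<xi>] eff by simp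
qed

end


section \<open>Geometric graphs\<close>

text \<open>Cutting the segment at \<open>x\<close> leaves two segments starting at
  \<open>x\<close>; closer to \<open>x\<close> than their far ends, each is indistinguishable from a
  ray. An endpoint equal to \<open>x\<close> yields no direction and is removed.\<close>

lemma closed_segment_mem_iff_sgn:
  fixes x :: "real ^ 'n"
  assumes x: "x \<in> closed_segment p q" and y: "y \<noteq> x"
    and p: "p \<noteq> x \<Longrightarrow> dist y x < dist p x" and q: "q \<noteq> x \<Longrightarrow> dist y x < dist q x"
  shows "y \<in> closed_segment p q \<longleftrightarrow> sgn (y - x) \<in> (\<lambda>z. sgn (z - x)) ` ({p, q} - {x})"
proof -
  have ray: "y \<in> closed_segment x z \<longleftrightarrow> z \<noteq> x \<and> sgn (y - x) = sgn (z - x)"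
    if z: "z \<noteq> x \<Longrightarrow> dist y x < dist z x" for z
  proof
    assume "y \<in> closed_segment x z"
    then obtain s where s: "0 \<le> s" "y = (1 - s) *\<^sub>R x + s *\<^sub>R z" by (auto simp: in_segment)
    then have "y - x = s *\<^sub>R (z - x)" by (simp add: algebra_simps)
    moreover from this have "s > 0" "z \<noteq> x" using y s(1) by (auto simp: order_less_le)
    ultimately show "z \<noteq> x \<and> sgn (y - x) = sgn (z - x)" by (simp add: sgn_scaleR_pos)
  next
    assume a: "z \<noteq> x \<and> sgn (y - x) = sgn (z - x)"
    \<comment> \<open>The ratio of distances is the convex parameter of \<open>y\<close>; it is at
      most 1 because \<open>y\<close> is closer to \<open>x\<close> than \<open>z\<close>
      is.\<close>
    define s where "s = norm (y - x) / norm (z - x)"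
    have "norm (z - x) *\<^sub>R sgn (z - x) = z - x" by (rule norm_scaleR_sgn)
    then have "s *\<^sub>R (z - x) = norm (y - x) *\<^sub>R sgn (z - x)"
      using a unfolding s_def by (simp add: sgn_div_norm divide_inverse)
    also have "\<dots> = y - x" using a norm_scaleR_sgn[of "y - x"] by simp
    finally have "y = (1 - s) *\<^sub>R x + s *\<^sub>R z" by (simp add: algebra_simps)
    moreover have "0 \<le> s" "s \<le> 1"
      using z a unfolding s_def by (auto simp: dist_norm field_simps)
    ultimately show "y \<in> closed_segment x z" by (auto simp: in_segment)
  qed
  have "closed_segment p q = closed_segment x p \<union> closed_segment x q"
    using Un_closed_segment[OF x] by (simp add: closed_segment_commute)
  then show ?thesis using ray[OF p] ray[OF q] by auto
qed

context
  fixes I :: "'i set" and a b :: "'i \<Rightarrow> real ^ 'n"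
  assumes graph: "geometric_graph I a b"
begin

abbreviation (input) seg :: "'i \<Rightarrow> (real ^ 'n) set"
  where "seg i \<equiv> closed_segment (a i) (b i)"

text \<open>Lets the global suprema, defined over the closure, run over the graph itself.\<close>

lemma graph_closed: "closed (\<Union>i\<in>I. seg i)"
proof -
  have "closedin euclidean (\<Union>(segments I a b))"
    using graph by (intro closedin_locally_finite_Union)
      (auto simp: geometric_graph_def segments_def)
  then show ?thesis by (simp add: segments_def)
qed

text \<open>Local finiteness leaves finitely many segments near \<open>x\<close>. Those missing
  \<open>x\<close> have a closed union, which a smaller ball avoids.\<close>

lemma graph_local_edges:
  obtains J r where "finite J" "J \<subseteq> I" "r > 0" "\<And>i. i \<in> J \<Longrightarrow> x \<in> seg i"
    "(\<Union>i\<in>I. seg i) \<inter> ball x r = (\<Union>i\<in>J. seg i) \<inter> ball x r"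
proof -
  have "locally_finite_in euclidean (segments I a b)"
    using graph by (simp only: geometric_graph_def)
  then have "\<exists>V. open V \<and> x \<in> V \<and> finite {S \<in> segments I a b. S \<inter> V \<noteq> {}}"
    by (simp add: locally_finite_in_def)
  then obtain V where V: "open V" "x \<in> V" "finite {S \<in> segments I a b. S \<inter> V \<noteq> {}}"
    by blast
  \<comment> \<open>Local finiteness counts segments, and infinitely many indices may carry the same
    one; \<open>K\<close> is a finite choice of representatives.\<close>
  obtain K where K: "K \<subseteq> I" "finite K" "{S \<in> segments I a b. S \<inter> V \<noteq> {}} = seg ` K"
    using finite_subset_image[OF V(3), of seg I] by (auto simp: segments_def)
  define J where "J = {i \<in> K. x \<in> seg i}"
  have "closed (\<Union>i\<in>K - J. seg i)"
    using K(2) by (intro closed_UN) auto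
  then have "open (V - (\<Union>i\<in>K - J. seg i))" using V(1) by blast
  moreover have "x \<in> V - (\<Union>i\<in>K - J. seg i)" using V(2) by (auto simp: J_def)
  ultimately obtain r where r: "r > 0" "ball x r \<subseteq> V - (\<Union>i\<in>K - J. seg i)"
    using open_contains_ball by blast
  have sub: "(\<Union>i\<in>I. seg i) \<inter> ball x r \<subseteq> (\<Union>i\<in>J. seg i)"
  proof
    fix y assume y: "y \<in> (\<Union>i\<in>I. seg i) \<inter> ball x r"
    then obtain i where i: "i \<in> I" "y \<in> seg i" "y \<in> V" using r by blast
    then have "seg i \<in> {S \<in> segments I a b. S \<inter> V \<noteq> {}}" by (auto simp: segments_def)
    then obtain j where "j \<in> K" "y \<in> seg j" using K(3) i(2) by auto
    then show "y \<in> (\<Union>i\<in>J. seg i)" using r(2) y by blast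
  qed
  show ?thesis
  proof (rule that)
    show JI: "J \<subseteq> I" using K(1) by (auto simp: J_def)
    show "(\<Union>i\<in>I. seg i) \<inter> ball x r = (\<Union>i\<in>J. seg i) \<inter> ball x r"
      using sub JI by blast
  qed (use K(2) r(1) in \<open>auto simp: J_def\<close>)
qed

text \<open>A radius not exceeding the distance from \<open>x\<close> to any other endpoint turns
  the incident edges into rays. The index set \<open>J\<close> is exposed for the analysis of
  non-nodes.\<close>

lemma graph_local_fan:
  assumes x: "x \<in> (\<Union>i\<in>I. seg i)"
  shows "\<exists>J r. J \<subseteq> I \<and> (\<forall>i\<in>J. x \<in> seg i) \<and>
    local_fan (\<Union>i\<in>I. seg i) x ((\<lambda>z. sgn (z - x)) ` (a ` J \<union> b ` J - {x})) r"
proof -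
  obtain J r where J: "finite J" "J \<subseteq> I" "r > 0" "\<And>i. i \<in> J \<Longrightarrow> x \<in> seg i"
    "(\<Union>i\<in>I. seg i) \<inter> ball x r = (\<Union>i\<in>J. seg i) \<inter> ball x r"
    using graph_local_edges[of x] by blast
  define P where "P = a ` J \<union> b ` J - {x}"
  have finP: "finite P" using J(1) by (simp add: P_def)
  define \<rho> where "\<rho> = Min (insert r ((\<lambda>z. dist z x) ` P))"
  have \<rho>: "\<rho> > 0" "\<rho> \<le> r" "\<And>z. z \<in> P \<Longrightarrow> \<rho> \<le> dist z x"
    unfolding \<rho>_def using finP J(3) by (auto simp: P_def)
  have "x \<in> (\<Union>i\<in>J. seg i)" using J(3,5) x by auto
  then obtain j where j: "j \<in> J" by blast
  \<comment> \<open>At most one endpoint of an edge can equal \<open>x\<close>, so a direction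
    exists.\<close>
  then have "a j \<noteq> b j" using J(2) graph by (auto simp: geometric_graph_def)
  then have "a j \<in> P \<or> b j \<in> P" using j by (auto simp: P_def)
  then have Pne: "P \<noteq> {}" by blast
  have "local_fan (\<Union>i\<in>I. seg i) x ((\<lambda>z. sgn (z - x)) ` P) \<rho>"
  proof
    show "(\<lambda>z. sgn (z - x)) ` P \<subseteq> sphere 0 1" by (auto simp: P_def norm_sgn split: if_splits)
    fix y assume y: "y \<noteq> x" "dist y x < \<rho>"
    have "y \<in> seg i \<longleftrightarrow> sgn (y - x) \<in> (\<lambda>z. sgn (z - x)) ` ({a i, b i} - {x})" if "i \<in> J" for i
      using that y \<rho>(3)[of "a i"] \<rho>(3)[of "b i"]
      by (intro closed_segment_mem_iff_sgn J(4)) (auto simp: P_def)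
    then have "y \<in> (\<Union>i\<in>J. seg i) \<longleftrightarrow> sgn (y - x) \<in> (\<lambda>z. sgn (z - x)) ` P"
      by (auto simp: P_def)
    moreover have "y \<in> ball x r" using y \<rho>(2) by (simp add: dist_commute)
    ultimately show "y \<in> (\<Union>i\<in>I. seg i) \<longleftrightarrow> sgn (y - x) \<in> (\<lambda>z. sgn (z - x)) ` P"
      using J(5) by blast
  qed (use x finP Pne \<rho>(1) in auto)
  then show ?thesis using J(2,4) unfolding P_def by blast
qed

section \<open>Ranks at arbitrary points and at non-nodes of a graph\<close>

lemma graph_pointwise:
  assumes x: "x \<in> (\<Union>i\<in>I. seg i)"
  shows "dim_Pvec (\<Union>i\<in>I. seg i) x = dim (span (edge_directions (\<Union>i\<in>I. seg i) x))"
    and "dim_cross (\<Union>i\<in>I. seg i) x =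
      ereal (real (dim (span (edge_directions (\<Union>i\<in>I. seg i) x))))"
    and "dim_Ptan (\<Union>i\<in>I. seg i) x = dim (span (edge_directions (\<Union>i\<in>I. seg i) x))"
    and "dim (span (edge_directions (\<Union>i\<in>I. seg i) x)) \<ge> 1"
proof -
  obtain J r where fan: "local_fan (\<Union>i\<in>I. seg i) x ((\<lambda>z. sgn (z - x)) ` (a ` J \<union> b ` J - {x})) r"
    using graph_local_fan[OF x] by blast
  note eq = local_fan.edge_directions_eq[OF fan]
  show "dim_Pvec (\<Union>i\<in>I. seg i) x = dim (span (edge_directions (\<Union>i\<in>I. seg i) x))"
    unfolding eq by (rule local_fan.dim_Pvec_eq[OF fan])
  show "dim_cross (\<Union>i\<in>I. seg i) x =
      ereal (real (dim (span (edge_directions (\<Union>i\<in>I. seg i) x))))"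
    unfolding eq by (rule local_fan.dim_cross_eq[OF fan])
  show "dim_Ptan (\<Union>i\<in>I. seg i) x = dim (span (edge_directions (\<Union>i\<in>I. seg i) x))"
    unfolding eq by (rule local_fan.dim_Ptan_eq[OF fan])
  show "dim (span (edge_directions (\<Union>i\<in>I. seg i) x)) \<ge> 1"
    unfolding eq by (rule local_fan.dim_span_pos[OF fan])
qed

text \<open>Two different edges meet only in common endpoints, so a non-node lies on a single
  segment and all its directions are parallel to that segment.\<close>

lemma graph_rank_non_node:
  assumes x: "x \<in> (\<Union>i\<in>I. seg i)" "x \<notin> nodes I a b"
  shows "dim (span (edge_directions (\<Union>i\<in>I. seg i) x)) \<le> 1"
proof -
  obtain J r where J: "J \<subseteq> I" "\<forall>i\<in>J. x \<in> seg i"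
    and fan: "local_fan (\<Union>i\<in>I. seg i) x ((\<lambda>z. sgn (z - x)) ` (a ` J \<union> b ` J - {x})) r"
    using graph_local_fan[OF x(1)] by (elim exE conjE) (rule that)
  obtain j where j: "j \<in> I" "x \<in> seg j" using x(1) by blast
  have same: "seg i = seg j" if "i \<in> J" for i
  proof (rule ccontr)
    assume "seg i \<noteq> seg j"
    then have "seg i \<inter> seg j = {} \<or> (\<exists>p \<in> {a i, b i} \<inter> {a j, b j}. seg i \<inter> seg j = {p})"
      using graph that J(1) j(1) unfolding geometric_graph_def by blast
    then have "x \<in> {a i, b i}" using J(2) that j(2) by blast
    then show False using x(2) that J(1) unfolding nodes_def by blast
  qed
  have diff: "z - x \<in> span {b j - a j}" if z: "z \<in> seg j" for z
  proof -
    obtain s t where st: "z = (1 - s) *\<^sub>R a j + s *\<^sub>R b j" "x = (1 - t) *\<^sub>R a j + t *\<^sub>R b j"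
      using z j(2) by (auto simp: in_segment)
    have "z - x = (s - t) *\<^sub>R (b j - a j)" unfolding st by (simp add: algebra_simps)
    then show ?thesis by (simp add: span_base span_scale)
  qed
  have "(\<lambda>z. sgn (z - x)) ` (a ` J \<union> b ` J - {x}) \<subseteq> span {b j - a j}"
  proof -
    have "a i \<in> seg j" "b i \<in> seg j" if "i \<in> J" for i
      by (rule subsetD[OF equalityD1[OF same[OF that]]], simp)+
    then show ?thesis using diff by (auto simp: sgn_div_norm intro: span_scale)
  qed
  then have "dim ((\<lambda>z. sgn (z - x)) ` (a ` J \<union> b ` J - {x})) \<le> card {b j - a j}"
    by (intro dim_le_card) auto
  then show ?thesis unfolding local_fan.edge_directions_eq[OF fan] by simp
qed

end

theorem proposition3p56:
  fixes I :: "'i set" and a b :: "'i \<Rightarrow> real ^ 'n" and G :: "(real ^ 'n) set"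
  assumes "geometric_graph I a b"
    and "G = (\<Union>i\<in>I. closed_segment (a i) (b i))"
  shows "(\<forall>x\<in>G.
            dim_Pvec G x = dim (span (edge_directions G x)) \<and>
            dim_cross G x = ereal (real (dim (span (edge_directions G x)))) \<and>
            dim_Ptan G x = dim (span (edge_directions G x))) \<and>
         (G \<noteq> {} \<longrightarrow>
            global_dim_Pvec G = Max ((\<lambda>v. dim (span (edge_directions G v))) ` nodes I a b) \<and>
            global_dim_cross G =
              ereal (real (Max ((\<lambda>v. dim (span (edge_directions G v))) ` nodes I a b))) \<and>
            global_dim_Ptan G = Max ((\<lambda>v. dim (span (edge_directions G v))) ` nodes I a b)) \<and>
         (G = {} \<longrightarrow>
            global_dim_Pvec G = 0 \<and> global_dim_cross G = 0 \<and> global_dim_Ptan G = 0)"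
proof -
  note pointwise = graph_pointwise[OF assms(1), folded assms(2)]
  define d where "d v = dim (span (edge_directions G v))" for v
  define M where "M = Max (d ` nodes I a b)"
  have global: "global_dim_Pvec G = M \<and> global_dim_cross G = ereal (real M) \<and> global_dim_Ptan G = M"
    if ne: "G \<noteq> {}"
  proof -
    have cl: "closure G = G" using graph_closed[OF assms(1)] assms(2) by simp
    have nG: "nodes I a b \<subseteq> G" unfolding nodes_def assms(2) by auto
    have nodes_ne: "nodes I a b \<noteq> {}" using ne unfolding nodes_def assms(2) by auto
    \<comment> \<open>There may be infinitely many nodes, but their ranks are bounded by the ambient
      dimension, so the maximum exists.\<close>
    have "d ` nodes I a b \<subseteq> {..CARD('n)}" using dim_span_le_CARD unfolding d_def by blast
    then have fin: "finite (d ` nodes I a b)" using finite_subset by blast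
    obtain v where v: "v \<in> G" "d v = M"
    proof -
      have "M \<in> d ` nodes I a b" unfolding M_def using nodes_ne by (intro Max_in[OF fin]) simp
      then show ?thesis using nG that by blast
    qed
    have le: "d x \<le> M" if x: "x \<in> G" for x
    proof (cases "x \<in> nodes I a b")
      case True
      then show ?thesis unfolding M_def using fin by simp
    next
      case False
      \<comment> \<open>A non-node has rank at most 1, which the rank at the maximising node
        \<open>v\<close> reaches.\<close>
      then have "d x \<le> 1"
        using graph_rank_non_node[OF assms(1), folded assms(2)] x unfolding d_def by blast
      also have "1 \<le> d v" using pointwise(4)[OF v(1)] unfolding d_def .
      finally show ?thesis using v(2) by simp
    qed
    have "(SUP x\<in>G. dim_Pvec G x) = M" "(SUP x\<in>G. dim_Ptan G x) = M"
      using v le pointwise(1,3) unfolding d_def by (intro cSup_eq_maximum; force)+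
    moreover have "(SUP x\<in>G. dim_cross G x) = ereal (real M)"
      using v le pointwise(2) unfolding d_def by (intro cSup_eq_maximum; force)
    ultimately show ?thesis
      using ne by (simp add: global_dim_Pvec_def global_dim_cross_def global_dim_Ptan_def cl)
  qed
  show ?thesis
    using pointwise(1-3) global unfolding M_def d_def
    by (auto simp: global_dim_Pvec_def global_dim_cross_def global_dim_Ptan_def)
qed

end
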